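(* Let $\boldsymbol{x}=(\boldsymbol{x}_1,\ldots,\boldsymbol{x}_\ell)$ and $\boldsymbol{y}=(\boldsymbol{y}_1,\ldots,\boldsymbol{y}_\ell)$ be time series in $\mathbb{R}^d$ of common length $\ell\ge2$, with signature kernel $K:[0,1]^2\to\mathbb{R}$, let $\kappa_{k,l}=K|_{T_{k,l}}$, and put $\ell':=\ell-1$. For each $k,l\in\{1,\ldots,\ell'\}$, the localised solution $\kappa_{k,l}$ has the tile-centered expansion $$\kappa_{k,l}(s,t)=\sum_{i,j=0}^\infty\tilde{c}^{(k,l)}_{i,j}(s-\sigma_k)^i(t-\tau_l)^j\qquad\text{for}\quad\tilde{C}^{k,l}\equiv\big(\tilde{c}^{(k,l)}_{i,j}\big)_{i,j\ge0}:=A_{k,l}\odot B_{k,l}\odot W,$$ uniformly in $(s,t)\in T_{k,l}$, where $W\equiv(w_{i,j})_{i,j\ge0}$ with $w_{i,j}:=\frac{(\max(i,j)-\min(i,j))!}{\max(i,j)!\,\min(i,j)!}$, $A_{k,l}:=\big(\rho_{k,l}^{\min(i,j)}\big)_{i,j\ge0}$, and the matrix $B_{k,l}\equiv\big(b^{(k,l)}_{i,j}\big)_{i,j\ge0}$ is defined by $$b^{(k,l)}_{i+r,i}:=\alpha^{(k,l)}_r\qquad\text{and}\qquad b^{(k,l)}_{i,i+r}:=\beta^{(k,l)}_r,\qquad\text{for each }(i,r)\in\mathbb{N}_0^2,$$ with boundary values $\alpha^{(k,1)}_r:=\delta_{0,r}$ for all $k\in\{1,\ldots,\ell'\}$ and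 $\beta^{(1,l)}_r:=\delta_{0,r}$ for all $l\in\{1,\ldots,\ell'\}$ (for each $r\in\mathbb{N}_0$), and recursively $$\big(\alpha^{(k,l)}_r\big)_{r\ge0}:=\tilde{C}^{k,l-1}\cdot\eta(1/\ell')\quad(l\ge2)\qquad\text{and}\qquad\big(\beta^{(k,l)}_r\big)_{r\ge0}:=\big[\tilde{C}^{k-1,l}\big]^{\dagger}\cdot\eta(1/\ell')\quad(k\ge2).$$
   Context: Grid and tiles: $\sigma_k:=\frac{k-1}{\ell-1}$, $\tau_l:=\frac{l-1}{\ell-1}$ for $k,l=1,\ldots,\ell$. For $k,l\in\{1,\ldots,\ell-1\}$: $\mathcal{D}_{k,l}:=(\sigma_k,\sigma_{k+1})\times(\tau_l,\tau_{l+1})$, $T_{k,l}:=[\sigma_k,\sigma_{k+1}]\times[\tau_l,\tau_{l+1}]$, and $\mathcal{D}:=\bigcup_{k,l=1}^{\ell-1}\mathcal{D}_{k,l}$. Coefficients: with $\Delta_k\boldsymbol{z}:=\boldsymbol{z}_{k+1}-\boldsymbol{z}_k$ and $\langle\cdot,\cdot\rangle$ the Euclidean inner product on $\mathbb{R}^d$, set $\rho_{k,l}:=(\ell-1)^2\langle\Delta_k\boldsymbol{x},\Delta_l\boldsymbol{y}\rangle$ for $k,l\in\{1,\ldots,\ell-1\}$. Define $\rho_{\boldsymbol{x},\boldsymbol{y}}(s,t):=\rho_{k,l}$ for $(s,t)\in\mathcal{D}_{k,l}$ and $\rho_{\boldsymbol{x},\boldsymbol{y}}:=0$ on $[0,1]^2\setminus\mathcal{D}$.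 (On $\mathcal{D}_{k,l}$ this equals $\langle\hat{\boldsymbol{x}}'(s),\hat{\boldsymbol{y}}'(t)\rangle$, where $\hat{\boldsymbol{x}},\hat{\boldsymbol{y}}:[0,1]\to\mathbb{R}^d$ are the continuous piecewise linear interpolants of $\boldsymbol{x},\boldsymbol{y}$ on the uniform grid.) Signature kernel: the signature kernel of $\boldsymbol{x}$ and $\boldsymbol{y}$ is the unique continuous function $K:[0,1]^2\to\mathbb{R}$ solving $\frac{\partial^2K}{\partial s\,\partial t}(s,t)=\rho_{\boldsymbol{x},\boldsymbol{y}}(s,t)K(s,t)$ for $(s,t)\in\mathcal{D}$ with $K(0,\cdot)=K(\cdot,0)=1$; equivalently, the unique continuous solution of $K(s,t)=1+\int_0^t\int_0^s\rho_{\boldsymbol{x},\boldsymbol{y}}(u,v)K(u,v)\,\mathrm{d}u\,\mathrm{d}v$ on $[0,1]^2$. Matrix notation: $\mathbb{N}_0=\{0,1,2,\ldots\}$; $\delta_{i,j}$ is the Kronecker delta; $\odot$ is the Hadamard (entrywise) product of doubly-infinite matrices, $(a_{i,j})\odot(b_{i,j}):=(a_{i,j}b_{i,j})$; $\eta(r):=(r^i)_{i\ge0}=(1,r,r^2,\ldots)$; for a doubly-infinite matrix $C=(c_{ij})_{i,j\ge0}$ and a sequence $a=(a_j)_{j\ge0}$, $C\cdot a:=\big(\sum_{j\ge0}c_{ij}a_j\big)_{i\ge0}$; $C^\dagger$ is the transpose of $C$; and $0^0=1$. *)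

theory Defs
  imports "HOL-Analysis.Analysis"
begin

text \<open>
  A time series \<open>(x_1, \<dots>, x_L)\<close> in \<open>\<real>^d\<close> is a function on \<^typ>\<open>nat\<close> of which only the values at
  \<open>1, \<dots>, L\<close> are used. All indices of points and tiles are 1-based, as in the mathematics;
  matrix and sequence indices start at 0.
\<close>

subsection \<open>Grid and tiles\<close>

text \<open>The two grids coincide: \<open>\<sigma>_k = \<tau>_k = grid L k\<close>.\<close>

definition grid :: "nat \<Rightarrow> nat \<Rightarrow> real" where
  "grid L k = (real k - 1) / (real L - 1)"

definition open_tile :: "nat \<Rightarrow> nat \<Rightarrow> nat \<Rightarrow> (real \<times> real) set" where
  "open_tile L k l = {grid L k<..<grid L (k + 1)} \<times> {grid L l<..<grid L (l + 1)}"

definition tile :: "nat \<Rightarrow> nat \<Rightarrow> nat \<Rightarrow> (real \<times> real) set" where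
  "tile L k l = {grid L k..grid L (k + 1)} \<times> {grid L l..grid L (l + 1)}"

definition open_tiles :: "nat \<Rightarrow> (real \<times> real) set" where
  "open_tiles L = (\<Union>k\<in>{1..L - 1}. \<Union>l\<in>{1..L - 1}. open_tile L k l)"

subsection \<open>The signature kernel\<close>

definition increment :: "(nat \<Rightarrow> real ^ 'd) \<Rightarrow> nat \<Rightarrow> real ^ 'd" where
  "increment z k = z (k + 1) - z k"

definition rho_coeff ::
    "nat \<Rightarrow> (nat \<Rightarrow> real ^ 'd) \<Rightarrow> (nat \<Rightarrow> real ^ 'd) \<Rightarrow> nat \<Rightarrow> nat \<Rightarrow> real" where
  "rho_coeff L x y k l = (real L - 1)\<^sup>2 * (increment x k \<bullet> increment y l)"

text \<open>
  The open tiles are pairwise disjoint, so this is \<open>\<rho>_{k,l}\<close> on the open tile \<open>(k, l)\<close>, and 0 off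
  all open tiles.
\<close>

definition rho_fun ::
    "nat \<Rightarrow> (nat \<Rightarrow> real ^ 'd) \<Rightarrow> (nat \<Rightarrow> real ^ 'd) \<Rightarrow> real \<times> real \<Rightarrow> real" where
  "rho_fun L x y p =
     (\<Sum>k\<in>{1..L - 1}. \<Sum>l\<in>{1..L - 1}. rho_coeff L x y k l * indicator (open_tile L k l) p)"

text \<open>
  \<open>K\<close> has, throughout the open set \<open>D\<close>, the mixed partial derivative
  \<open>\<partial>/\<partial>s (\<partial>K/\<partial>t) = f\<close>; the witness \<open>Kt\<close> is \<open>\<partial>K/\<partial>t\<close>.
\<close>

definition has_mixed_partial_on ::
    "(real \<times> real \<Rightarrow> real) \<Rightarrow> (real \<times> real \<Rightarrow> real) \<Rightarrow> (real \<times> real) set \<Rightarrow> bool" where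
  "has_mixed_partial_on K f D \<longleftrightarrow>
     (\<exists>Kt. \<forall>(s, t)\<in>D.
        ((\<lambda>v. K (s, v)) has_real_derivative Kt (s, t)) (at t) \<and>
        ((\<lambda>u. Kt (u, t)) has_real_derivative f (s, t)) (at s))"

text \<open>Only the values of \<open>K\<close> on the closed unit square are constrained.\<close>

definition is_signature_kernel ::
    "nat \<Rightarrow> (nat \<Rightarrow> real ^ 'd) \<Rightarrow> (nat \<Rightarrow> real ^ 'd) \<Rightarrow> (real \<times> real \<Rightarrow> real) \<Rightarrow> bool" where
  "is_signature_kernel L x y K \<longleftrightarrow>
     continuous_on ({0..1} \<times> {0..1}) K \<and>
     has_mixed_partial_on K (\<lambda>p. rho_fun L x y p * K p) (open_tiles L) \<and>
     (\<forall>t\<in>{0..1}. K (0, t) = 1) \<and>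
     (\<forall>s\<in>{0..1}. K (s, 0) = 1)"

subsection \<open>Doubly infinite matrices\<close>

type_synonym inf_matrix = "nat \<Rightarrow> nat \<Rightarrow> real"

definition hadamard :: "inf_matrix \<Rightarrow> inf_matrix \<Rightarrow> inf_matrix" (infixl "\<odot>" 70) where
  "A \<odot> B = (\<lambda>i j. A i j * B i j)"

definition mat_seq :: "inf_matrix \<Rightarrow> (nat \<Rightarrow> real) \<Rightarrow> nat \<Rightarrow> real" where
  "mat_seq C a = (\<lambda>i. \<Sum>j. C i j * a j)"

definition inf_transpose :: "inf_matrix \<Rightarrow> inf_matrix" where
  "inf_transpose C = (\<lambda>i j. C j i)"

definition eta :: "real \<Rightarrow> nat \<Rightarrow> real" where
  "eta r = (\<lambda>i. r ^ i)"

definition delta_seq :: "nat \<Rightarrow> real" where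
  "delta_seq = (\<lambda>r. if r = 0 then 1 else 0)"

definition W_mat :: inf_matrix where
  "W_mat = (\<lambda>i j. fact (max i j - min i j) / (fact (max i j) * fact (min i j)))"

definition A_mat ::
    "nat \<Rightarrow> (nat \<Rightarrow> real ^ 'd) \<Rightarrow> (nat \<Rightarrow> real ^ 'd) \<Rightarrow> nat \<Rightarrow> nat \<Rightarrow> inf_matrix" where
  "A_mat L x y k l = (\<lambda>i j. rho_coeff L x y k l ^ min i j)"

text \<open>
  The Toeplitz matrix with first column \<open>a\<close> and first row \<open>b\<close>. It satisfies
  \<open>toeplitz a b (i + r) i = a r\<close> for all \<open>r\<close>, but \<open>toeplitz a b i (i + r) = b r\<close> for \<open>r = 0\<close>
  only if \<open>a 0 = b 0\<close>. For the sequences below this compatibility is not immediate from the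
  recursion.
\<close>

definition toeplitz :: "(nat \<Rightarrow> real) \<Rightarrow> (nat \<Rightarrow> real) \<Rightarrow> inf_matrix" where
  "toeplitz a b = (\<lambda>i j. if j \<le> i then a (i - j) else b (j - i))"

text \<open>
  The sequences \<open>\<alpha>^{(k,l)}\<close>, \<open>\<beta>^{(k,l)}\<close>, the matrix \<open>B_{k,l}\<close> and the coefficient matrix of tile
  \<open>(k, l)\<close>, with \<open>real L - 1\<close> in the role of \<open>\<ell>'\<close>. Only
  \<open>1 \<le> k, l \<le> L - 1\<close> is meaningful; the index 0 is treated like 1.
\<close>

function alpha ::
    "nat \<Rightarrow> (nat \<Rightarrow> real ^ 'd) \<Rightarrow> (nat \<Rightarrow> real ^ 'd) \<Rightarrow> nat \<Rightarrow> nat \<Rightarrow> nat \<Rightarrow> real"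
  and beta ::
    "nat \<Rightarrow> (nat \<Rightarrow> real ^ 'd) \<Rightarrow> (nat \<Rightarrow> real ^ 'd) \<Rightarrow> nat \<Rightarrow> nat \<Rightarrow> nat \<Rightarrow> real"
  and B_mat ::
    "nat \<Rightarrow> (nat \<Rightarrow> real ^ 'd) \<Rightarrow> (nat \<Rightarrow> real ^ 'd) \<Rightarrow> nat \<Rightarrow> nat \<Rightarrow> inf_matrix"
  and C_mat ::
    "nat \<Rightarrow> (nat \<Rightarrow> real ^ 'd) \<Rightarrow> (nat \<Rightarrow> real ^ 'd) \<Rightarrow> nat \<Rightarrow> nat \<Rightarrow> inf_matrix"
where
  "alpha L x y k l =
     (if l \<le> 1 then delta_seq
      else mat_seq (C_mat L x y k (l - 1)) (eta (1 / (real L - 1))))"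
| "beta L x y k l =
     (if k \<le> 1 then delta_seq
      else mat_seq (inf_transpose (C_mat L x y (k - 1) l)) (eta (1 / (real L - 1))))"
| "B_mat L x y k l = toeplitz (alpha L x y k l) (beta L x y k l)"
| "C_mat L x y k l = A_mat L x y k l \<odot> B_mat L x y k l \<odot> W_mat"
  by pat_completeness auto

termination
  by (relation "Wellfounded.measure (\<lambda>z. case z of
        Inl (Inl (L, x, y, k, l)) \<Rightarrow> 3 * (k + l)
      | Inl (Inr (L, x, y, k, l)) \<Rightarrow> 3 * (k + l)
      | Inr (Inl (L, x, y, k, l)) \<Rightarrow> 3 * (k + l) + 1
      | Inr (Inr (L, x, y, k, l)) \<Rightarrow> 3 * (k + l) + 2)") auto

declare alpha.simps [simp del] beta.simps [simp del] B_mat.simps [simp del] C_mat.simps [simp del]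

end

theory Submission
  imports Defs
begin

text \<open>
  On one tile the kernel solves a Goursat problem: its mixed partial derivative is \<open>\<rho> K\<close> with a
  constant \<open>\<rho>\<close>, and its values on the bottom and left edges are given. If these values are power
  series with coefficients \<open>\<alpha>\<close> and \<open>\<beta>\<close>, comparing coefficients in \<open>\<partial>\<^sub>s \<partial>\<^sub>t \<Sum> c\<^sub>i\<^sub>j s\<^sup>i t\<^sup>j = \<rho> \<Sum> c\<^sub>i\<^sub>j s\<^sup>i t\<^sup>j\<close>
  gives \<open>(i + 1) (j + 1) c\<^bsub>i+1,j+1\<^esub> = \<rho> c\<^bsub>i,j\<^esub>\<close>. Each diagonal is thus a recurrence that starts on the
  boundary, and its solution is the product of a power of \<open>\<rho>\<close>, a Toeplitz entry and a quotient of
  factorials. Three facts turn this formal computation into a proof.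

  Convergence. Let \<open>h\<close> be the side of a tile. The \<open>n\<close>-th entry of a diagonal carries a factor of size at
  most \<open>|\<rho>|\<^sup>n/n!\<close>, so
  \<open>\<Sum> |c\<^sub>i\<^sub>j| h\<^sup>i h\<^sup>j\<close> is finite as soon as \<open>\<Sum> |\<alpha>\<^sub>r| h\<^sup>r\<close> and \<open>\<Sum> |\<beta>\<^sub>r| h\<^sup>r\<close> are
  (\<open>goursat_coeff_box_summable\<close>). Conversely, a finite double sum makes the edge coefficients passed on
  to the neighbouring tiles absolutely summable at the same radius \<open>h\<close>
  (\<open>mat_seq_abs_summable\<close>). So this condition is an invariant that survives the recursion over tiles
  without any loss of radius, and it also yields uniform convergence by the Weierstrass M-test.

  Uniqueness. The sum of the series is compared with \<open>K\<close> without differentiating it. The difference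
  \<open>E\<^sub>n\<close> of \<open>K\<close> and the partial sum over \<open>i, j \<le> n\<close> satisfies \<open>\<partial>\<^sub>s \<partial>\<^sub>t E\<^sub>n\<^sub>+\<^sub>1 = \<rho> E\<^sub>n\<close> exactly, since
  partial sums are polynomials, and it converges uniformly to a limit that vanishes on the two edges.
  The solution operator is a contraction in an exponentially weighted sup norm, so the
  limit is zero (\<open>goursat_uniqueness_limit\<close>). In place of double integrals, the proof compares
  increments over rectangles, whose sign is determined by that of the mixed partial derivative
  (\<open>rect_increment_nonpos\<close>).

  Gluing. By continuity of \<open>K\<close>, the top edge of one tile provides the bottom values of the next, and
  the right edge the left values. Induction over the tiles then gives the expansion everywhere
  (\<open>signature_kernel_tile_expansion\<close>). The two edge series of a tile agree at the corner because both
  take the value of \<open>K\<close> there, so \<open>\<alpha>\<^sub>0 = \<beta>\<^sub>0\<close> and the Toeplitz matrix has the prescribed first row.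
\<close>

section \<open>Mixed partial derivatives and rectangle increments\<close>

definition rect_increment :: "(real \<times> real \<Rightarrow> real) \<Rightarrow> real \<Rightarrow> real \<Rightarrow> real \<Rightarrow> real \<Rightarrow> real" where
  "rect_increment E a b s t = E (s, t) - E (a, t) - E (s, b) + E (a, b)"

lemma has_mixed_partial_on_diff:
  assumes "has_mixed_partial_on f f' D" "has_mixed_partial_on g g' D"
  shows "has_mixed_partial_on (\<lambda>p. f p - g p) (\<lambda>p. f' p - g' p) D"
proof -
  obtain ft where "\<forall>(s, t)\<in>D. ((\<lambda>v. f (s, v)) has_real_derivative ft (s, t)) (at t) \<and>
      ((\<lambda>u. ft (u, t)) has_real_derivative f' (s, t)) (at s)"
    using assms(1) unfolding has_mixed_partial_on_def by blast
  moreover obtain gt where "\<forall>(s, t)\<in>D. ((\<lambda>v. g (s, v)) has_real_derivative gt (s, t)) (at t) \<and>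
      ((\<lambda>u. gt (u, t)) has_real_derivative g' (s, t)) (at s)"
    using assms(2) unfolding has_mixed_partial_on_def by blast
  ultimately show ?thesis
    unfolding has_mixed_partial_on_def
    by (intro exI[of _ "\<lambda>p. ft p - gt p"]) (auto intro!: DERIV_diff)
qed

lemma has_mixed_partial_on_cmult:
  assumes "has_mixed_partial_on f f' D"
  shows "has_mixed_partial_on (\<lambda>p. c * f p) (\<lambda>p. c * f' p) D"
proof -
  obtain ft where "\<forall>(s, t)\<in>D. ((\<lambda>v. f (s, v)) has_real_derivative ft (s, t)) (at t) \<and>
      ((\<lambda>u. ft (u, t)) has_real_derivative f' (s, t)) (at s)"
    using assms(1) unfolding has_mixed_partial_on_def by blast
  then show ?thesis
    unfolding has_mixed_partial_on_def
    by (intro exI[of _ "\<lambda>p. c * ft p"]) (auto intro!: DERIV_cmult)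
qed

lemma has_mixed_partial_on_sum:
  assumes "\<And>i. i \<in> I \<Longrightarrow> has_mixed_partial_on (f i) (f' i) D"
  shows "has_mixed_partial_on (\<lambda>p. \<Sum>i\<in>I. f i p) (\<lambda>p. \<Sum>i\<in>I. f' i p) D"
proof -
  have "\<forall>i\<in>I. \<exists>ft. \<forall>(s, t)\<in>D. ((\<lambda>v. f i (s, v)) has_real_derivative ft (s, t)) (at t) \<and>
      ((\<lambda>u. ft (u, t)) has_real_derivative f' i (s, t)) (at s)"
    using assms unfolding has_mixed_partial_on_def by blast
  then obtain ft where "\<forall>i\<in>I. \<forall>(s, t)\<in>D.
      ((\<lambda>v. f i (s, v)) has_real_derivative ft i (s, t)) (at t) \<and>
      ((\<lambda>u. ft i (u, t)) has_real_derivative f' i (s, t)) (at s)"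
    unfolding bchoice_iff by blast
  then show ?thesis
    unfolding has_mixed_partial_on_def
    by (intro exI[of _ "\<lambda>p. \<Sum>i\<in>I. ft i p"]) (auto intro!: DERIV_sum)
qed

lemma has_mixed_partial_on_product:
  assumes "\<And>s. (f has_real_derivative f' s) (at s)" "\<And>t. (g has_real_derivative g' t) (at t)"
  shows "has_mixed_partial_on (\<lambda>(s, t). f s * g t) (\<lambda>(s, t). f' s * g' t) D"
  unfolding has_mixed_partial_on_def
  by (intro exI[of _ "\<lambda>(s, t). f s * g' t"])
     (auto intro!: DERIV_cmult DERIV_cmult_right assms)

lemma has_mixed_partial_on_subset:
  "has_mixed_partial_on f f' D \<Longrightarrow> D' \<subseteq> D \<Longrightarrow> has_mixed_partial_on f f' D'"
  unfolding has_mixed_partial_on_def by blast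

lemma has_mixed_partial_on_cong:
  assumes "has_mixed_partial_on f g D" "\<And>p. p \<in> D \<Longrightarrow> g p = g' p"
  shows "has_mixed_partial_on f g' D"
proof -
  obtain ft where "\<forall>(s, t)\<in>D. ((\<lambda>v. f (s, v)) has_real_derivative ft (s, t)) (at t) \<and>
      ((\<lambda>u. ft (u, t)) has_real_derivative g (s, t)) (at s)"
    using assms(1) unfolding has_mixed_partial_on_def by blast
  then show ?thesis
    unfolding has_mixed_partial_on_def using assms(2)
    by (intro exI[of _ ft]) fastforce
qed

text \<open>
  Two applications of monotonicity: \<open>G \<le> 0\<close> makes \<open>\<partial>\<^sub>t E\<close> nonincreasing in \<open>s\<close>, so the difference of two
  vertical slices of \<open>E\<close> has nonpositive derivative in \<open>t\<close>. This stays in the open rectangle because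
  nothing is known about derivatives on its boundary.
\<close>

lemma rect_increment_nonpos_interior:
  assumes mixed: "has_mixed_partial_on E G ({a<..<a'} \<times> {b<..<b'})"
    and G: "\<And>u v. a < u \<Longrightarrow> u < a' \<Longrightarrow> b < v \<Longrightarrow> v < b' \<Longrightarrow> G (u, v) \<le> 0"
    and s: "a < s0" "s0 < s" "s < a'" and t: "b < t0" "t0 < t" "t < b'"
  shows "rect_increment E s0 t0 s t \<le> 0"
proof -
  obtain Et where Et: "\<forall>(s, t)\<in>{a<..<a'} \<times> {b<..<b'}.
      ((\<lambda>v. E (s, v)) has_real_derivative Et (s, t)) (at t) \<and>
      ((\<lambda>u. Et (u, t)) has_real_derivative G (s, t)) (at s)"
    using mixed unfolding has_mixed_partial_on_def by blast
  have dE: "((\<lambda>v. E (u, v)) has_real_derivative Et (u, v)) (at v)"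
    and dEt: "((\<lambda>u. Et (u, v)) has_real_derivative G (u, v)) (at u)"
    if "a < u" "u < a'" "b < v" "v < b'" for u v
    using bspec[OF Et, of "(u, v)"] that by auto
  have Et_le: "Et (s, v) \<le> Et (s0, v)" if v: "b < v" "v < b'" for v
  proof (rule DERIV_nonpos_imp_nonincreasing[where f = "\<lambda>u. Et (u, v)"])
    fix u assume "s0 \<le> u" "u \<le> s"
    then show "\<exists>y. ((\<lambda>u. Et (u, v)) has_real_derivative y) (at u) \<and> y \<le> 0"
      using s v by (intro exI[of _ "G (u, v)"] conjI dEt G) linarith+
  qed (use s in simp)
  have "E (s, t) - E (s0, t) \<le> E (s, t0) - E (s0, t0)"
  proof (rule DERIV_nonpos_imp_nonincreasing[where f = "\<lambda>v. E (s, v) - E (s0, v)"])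
    fix v assume "t0 \<le> v" "v \<le> t"
    then show "\<exists>y. ((\<lambda>v. E (s, v) - E (s0, v)) has_real_derivative y) (at v) \<and> y \<le> 0"
      using s t Et_le[of v]
      by (intro exI[of _ "Et (s, v) - Et (s0, v)"] conjI DERIV_diff dE) simp_all
  qed (use t in simp)
  then show ?thesis by (simp add: rect_increment_def)
qed

text \<open>
  Continuity of \<open>E\<close> carries the sign over to rectangles that touch the boundary.
\<close>

lemma rect_increment_nonpos:
  assumes cont: "continuous_on ({a..a'} \<times> {b..b'}) E"
    and mixed: "has_mixed_partial_on E G ({a<..<a'} \<times> {b<..<b'})"
    and G: "\<And>u v. a < u \<Longrightarrow> u < a' \<Longrightarrow> b < v \<Longrightarrow> v < b' \<Longrightarrow> G (u, v) \<le> 0"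
    and st: "s \<in> {a..a'}" "t \<in> {b..b'}"
  shows "rect_increment E a b s t \<le> 0"
proof (cases "s = a \<or> t = b")
  case True
  then show ?thesis by (auto simp: rect_increment_def)
next
  case False
  then have st': "a < s" "s \<le> a'" "b < t" "t \<le> b'" using st by auto
  \<comment> \<open>Shrink the rectangle by the relative margin \<open>e n < 1/2\<close> on each side, then let \<open>n\<close> tend to infinity.\<close>
  define e where "e = (\<lambda>n. 1 / real (n + 3))"
  have e: "0 < e n" "2 * e n < 1" for n by (auto simp: e_def field_simps)
  have e0: "e \<longlonglongrightarrow> 0"
    unfolding e_def using LIMSEQ_ignore_initial_segment[OF lim_1_over_n, of 3] by simp
  define lo hi where "lo = (\<lambda>c d n. c + e n * (d - c))" and "hi = (\<lambda>c d n. d - e n * (d - c))"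
  have lo_hi: "c < lo c d n" "lo c d n < hi c d n" "hi c d n < d" if "c < d" for c d :: real and n
  proof -
    have "2 * e n * (d - c) < 1 * (d - c)" using e[of n] that by (intro mult_strict_right_mono) auto
    then show "lo c d n < hi c d n" by (simp add: lo_def hi_def algebra_simps)
    show "c < lo c d n" "hi c d n < d" using e[of n] that by (auto simp: lo_def hi_def)
  qed
  have lim: "lo c d \<longlonglongrightarrow> c" "hi c d \<longlonglongrightarrow> d" for c d
    using tendsto_add[OF tendsto_const[of c] tendsto_mult_right[OF e0, of "d - c"]]
      tendsto_diff[OF tendsto_const[of d] tendsto_mult_right[OF e0, of "d - c"]]
    by (simp_all add: lo_def hi_def mult.commute)
  have E_lim: "(\<lambda>n. E (f n, g n)) \<longlonglongrightarrow> E (u, v)"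
    if "f \<longlonglongrightarrow> u" "g \<longlonglongrightarrow> v" "u \<in> {a..s}" "v \<in> {b..t}" "\<And>n. f n \<in> {a..s}" "\<And>n. g n \<in> {b..t}"
    for f g u v
  proof (rule continuous_on_tendsto_compose[OF cont])
    show "\<forall>\<^sub>F n in sequentially. (f n, g n) \<in> {a..a'} \<times> {b..b'}"
    proof (intro always_eventually allI)
      fix n show "(f n, g n) \<in> {a..a'} \<times> {b..b'}" using that(5,6)[of n] st' by auto
    qed
  qed (use that st' in \<open>auto intro: tendsto_Pair\<close>)
  have in_box: "lo a s n \<in> {a..s}" "hi a s n \<in> {a..s}" "lo b t n \<in> {b..t}" "hi b t n \<in> {b..t}" for n
    using lo_hi[OF st'(1), of n] lo_hi[OF st'(3), of n] by auto
  have "(\<lambda>n. rect_increment E (lo a s n) (lo b t n) (hi a s n) (hi b t n))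
      \<longlonglongrightarrow> rect_increment E a b s t"
    unfolding rect_increment_def using st' in_box
    by (intro tendsto_add tendsto_diff E_lim lim) auto
  moreover have "rect_increment E (lo a s n) (lo b t n) (hi a s n) (hi b t n) \<le> 0" for n
    using lo_hi[OF st'(1), of n] lo_hi[OF st'(3), of n] st'
    by (intro rect_increment_nonpos_interior[OF mixed G]) auto
  ultimately show ?thesis by (intro LIMSEQ_le_const2[where x = "rect_increment E a b s t"]) auto
qed

text \<open>
  The comparison principle that replaces estimates of double integrals.
\<close>

lemma rect_increment_le:
  assumes cont: "continuous_on ({a..a'} \<times> {b..b'}) E" "continuous_on ({a..a'} \<times> {b..b'}) F"
    and mixed: "has_mixed_partial_on E G ({a<..<a'} \<times> {b<..<b'})"
      "has_mixed_partial_on F H ({a<..<a'} \<times> {b<..<b'})"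
    and GH: "\<And>u v. a < u \<Longrightarrow> u < a' \<Longrightarrow> b < v \<Longrightarrow> v < b' \<Longrightarrow> G (u, v) \<le> H (u, v)"
    and st: "s \<in> {a..a'}" "t \<in> {b..b'}"
  shows "rect_increment E a b s t \<le> rect_increment F a b s t"
proof -
  have "rect_increment (\<lambda>p. E p - F p) a b s t \<le> 0"
    using st GH
    by (intro rect_increment_nonpos[OF continuous_on_diff[OF cont] has_mixed_partial_on_diff[OF mixed]])
       auto
  then show ?thesis by (simp add: rect_increment_def)
qed

text \<open>
  With the weight \<open>w(u, v) = exp(\<lambda>(u - a)) exp(\<lambda>(v - b))\<close>, whose mixed partial derivative is
  \<open>\<lambda>\<^sup>2 w\<close>, a bound \<open>|E| \<le> M w\<close> improves to \<open>|E| \<le> (|\<rho>|/\<lambda>\<^sup>2) M w\<close>. For \<open>\<lambda>\<^sup>2 > 2|\<rho>|\<close> the optimal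
  \<open>M\<close> must therefore be zero. The differential equation is required only of the approximations \<open>E\<^sub>n\<close>,
  with a shift of index, so that the lemma applies to the partial sums of a series whose limit has not
  been shown to be differentiable.
\<close>

lemma goursat_uniqueness_limit:
  fixes E :: "real \<times> real \<Rightarrow> real"
  defines "R \<equiv> \<lambda>a a' b b'. {a..a'::real} \<times> {b..b'::real}"
  assumes lim: "uniform_limit (R a a' b b') En E sequentially"
    and cont: "\<And>n. continuous_on (R a a' b b') (En n)"
    and mixed: "\<And>n. has_mixed_partial_on (En (Suc n)) (\<lambda>p. \<rho> * En n p) ({a<..<a'} \<times> {b<..<b'})"
    and zero: "\<And>s. s \<in> {a..a'} \<Longrightarrow> E (s, b) = 0" "\<And>t. t \<in> {b..b'} \<Longrightarrow> E (a, t) = 0"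
    and p: "p \<in> R a a' b b'"
  shows "E p = 0"
proof -
  define lam where "lam = sqrt (2 * \<bar>\<rho>\<bar> + 1)"
  have lam: "lam > 0" "lam * lam = 2 * \<bar>\<rho>\<bar> + 1" by (auto simp: lam_def add_nonneg_pos)
  define w where "w = (\<lambda>(u, v). exp (lam * (u - a)) * exp (lam * (v - b)))"
  define q where "q = \<bar>\<rho>\<bar> / (lam * lam)"
  have q: "0 \<le> q" "q \<le> 1 / 2" "q * (lam * lam) = \<bar>\<rho>\<bar>"
    using lam by (auto simp: q_def field_simps)
  have w_pos: "w z > 0" for z by (simp add: w_def split: prod.split)
  have w_ge1: "w z \<ge> 1" if "z \<in> R a a' b b'" for z
    using that lam mult_mono[of 1 _ 1 "exp _ :: real"] by (auto simp: w_def R_def)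
  have w_mixed: "has_mixed_partial_on w (\<lambda>p. (lam * lam) * w p) D" for D
  proof -
    have "has_mixed_partial_on w (\<lambda>(s, t). (lam * exp (lam * (s - a))) * (lam * exp (lam * (t - b)))) D"
      unfolding w_def
      by (rule has_mixed_partial_on_product) (auto intro!: derivative_eq_intros)
    then show ?thesis by (rule has_mixed_partial_on_cong) (auto simp: w_def)
  qed
  have w_cont: "continuous_on D w" for D
    unfolding w_def case_prod_unfold by (intro continuous_intros)
  have w_rect: "rect_increment w a b s t \<le> w (s, t)" if "(s, t) \<in> R a a' b b'" for s t
  proof -
    have "exp (lam * (t - b)) \<ge> 1" using that lam by (auto simp: R_def)
    then have "1 \<le> exp (lam * (s - a)) + exp (lam * (t - b))" 
      by (smt (verit) exp_gt_zero)
    then show ?thesis by (simp add: rect_increment_def w_def)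
  qed
  have E_cont: "continuous_on (R a a' b b') E"
    using cont by (intro uniform_limit_theorem[OF _ lim] always_eventually) auto
  have "compact (R a a' b b')" by (auto simp: R_def intro: compact_Times)
  moreover have "continuous_on (R a a' b b') (\<lambda>z. \<bar>E z\<bar> / w z)"
    using w_pos by (intro continuous_intros E_cont w_cont) (metis less_irrefl)
  ultimately obtain z0 where z0: "z0 \<in> R a a' b b'"
    and max: "\<And>z. z \<in> R a a' b b' \<Longrightarrow> \<bar>E z\<bar> / w z \<le> \<bar>E z0\<bar> / w z0"
    using continuous_attains_sup[of "R a a' b b'"] p by (metis (no_types, lifting) empty_iff)
  define M where "M = \<bar>E z0\<bar> / w z0"
  have M: "M \<ge> 0" using w_pos[of z0] by (simp add: M_def)
  have E_le: "\<bar>E z\<bar> \<le> M * w z" if "z \<in> R a a' b b'" for z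
    using max[OF that] w_pos[of z] by (simp add: M_def pos_divide_le_eq)
  \<comment> \<open>The sign \<open>sg\<close> turns the one-sided comparison into a bound on the absolute value. The slack \<open>e\<close> absorbs the distance of the approximations from \<open>E\<close>.\<close>
  have step: "sg * E (s, t) \<le> q * (M + e) * w (s, t)"
    if st: "(s, t) \<in> R a a' b b'" and e: "e > 0" and sg: "\<bar>sg\<bar> = 1" for s t e sg :: real
  proof -
    obtain N where N: "\<And>n z. n \<ge> N \<Longrightarrow> z \<in> R a a' b b' \<Longrightarrow> \<bar>En n z - E z\<bar> < e"
      using uniform_limitD[OF lim e] by (auto simp: eventually_sequentially dist_real_def)
    have "sg * rect_increment (En (Suc n)) a b s t \<le> q * (M + e) * w (s, t)" if n: "n \<ge> N" for n
    proof -
      have bound: "sg * (\<rho> * En n (u, v)) \<le> q * (M + e) * (lam * lam * w (u, v))"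
        if uv: "(u, v) \<in> R a a' b b'" for u v
      proof -
        have "\<bar>En n (u, v)\<bar> \<le> M * w (u, v) + e * 1"
          using N[OF n uv] E_le[OF uv] by linarith
        also have "\<dots> \<le> (M + e) * w (u, v)"
          using w_ge1[OF uv] e by (simp add: distrib_right)
        finally have "\<bar>\<rho>\<bar> * \<bar>En n (u, v)\<bar> \<le> \<bar>\<rho>\<bar> * ((M + e) * w (u, v))"
          by (rule mult_left_mono) simp
        moreover have "sg * (\<rho> * En n (u, v)) \<le> \<bar>\<rho>\<bar> * \<bar>En n (u, v)\<bar>"
          using abs_ge_self[of "sg * (\<rho> * En n (u, v))"] sg by (simp add: abs_mult)
        ultimately have "sg * (\<rho> * En n (u, v)) \<le> q * (lam * lam) * ((M + e) * w (u, v))"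
          unfolding q(3) by linarith
        then show ?thesis by (simp add: mult_ac)
      qed
      have "rect_increment (\<lambda>p. sg * En (Suc n) p) a b s t
          \<le> rect_increment (\<lambda>p. q * (M + e) * w p) a b s t"
        using st bound
        by (intro rect_increment_le[OF _ _ has_mixed_partial_on_cmult[OF mixed]
              has_mixed_partial_on_cmult[OF w_mixed]] continuous_intros w_cont
              cont[unfolded R_def]) (auto simp: R_def)
      also have "\<dots> = q * (M + e) * rect_increment w a b s t"
        by (simp add: rect_increment_def algebra_simps)
      also have "\<dots> \<le> q * (M + e) * w (s, t)"
        using w_rect[OF st] q M e by (intro mult_left_mono) auto
      finally show ?thesis by (simp add: rect_increment_def algebra_simps)
    qed
    moreover have "(\<lambda>n. sg * rect_increment (En (Suc n)) a b s t) \<longlonglongrightarrow> sg * rect_increment E a b s t"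
    proof -
      have "(\<lambda>n. En (Suc n) z) \<longlonglongrightarrow> E z" if "z \<in> R a a' b b'" for z
        using tendsto_uniform_limitI[OF lim that] by (rule LIMSEQ_Suc)
      then show ?thesis unfolding rect_increment_def
        using st by (intro tendsto_intros) (auto simp: R_def)
    qed
    ultimately have "sg * rect_increment E a b s t \<le> q * (M + e) * w (s, t)"
      by (intro LIMSEQ_le_const2) auto
    moreover have "rect_increment E a b s t = E (s, t)"
      using st zero by (auto simp: rect_increment_def R_def)
    ultimately show ?thesis by simp
  qed
  obtain s0 t0 where st0: "z0 = (s0, t0)" by force
  have "\<bar>E z0\<bar> \<le> q * M * w z0 + e" if e: "e > 0" for e
  proof -
    define d where "d = e / w z0"
    have d: "d > 0" "d * w z0 = e" using e w_pos[of z0] by (auto simp: d_def)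
    have "sg * E z0 \<le> q * M * w z0 + e" if "\<bar>sg\<bar> = 1" for sg :: real
    proof -
      have "sg * E z0 \<le> q * (M + d) * w z0"
        using step[of s0 t0 d sg] z0 d that st0 by simp
      also have "\<dots> = q * M * w z0 + q * e" using d(2) by (simp add: algebra_simps)
      also have "q * e \<le> 1 * e" using q e by (intro mult_right_mono) auto
      finally show ?thesis by simp
    qed
    from this[of 1] this[of "-1"] show ?thesis by simp
  qed
  then have "\<bar>E z0\<bar> \<le> q * M * w z0" by (rule field_le_epsilon)
  then have "\<bar>E z0\<bar> / w z0 \<le> q * M" using w_pos[of z0] by (simp add: pos_divide_le_eq)
  then have "M \<le> q * M" by (simp add: M_def)
  also have "q * M \<le> 1 / 2 * M" using q M by (intro mult_right_mono) auto
  finally have "M = 0" using M by simp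
  then show "E p = 0" using E_le[OF p] by simp
qed

section \<open>Absolutely summable double power series\<close>

text \<open>
  The invariant of the recursion over tiles: absolute convergence at the far corner \<open>(h, h)\<close>, hence
  on the whole closed tile.
\<close>

definition box_summable :: "inf_matrix \<Rightarrow> real \<Rightarrow> bool" where
  "box_summable c h \<longleftrightarrow> (\<lambda>(i, j). \<bar>c i j\<bar> * h ^ i * h ^ j) summable_on UNIV"

definition double_series :: "inf_matrix \<Rightarrow> real \<Rightarrow> real \<Rightarrow> real" where
  "double_series c s t = (\<Sum>\<^sub>\<infinity>(i, j). c i j * s ^ i * t ^ j)"

lemma double_term_le:
  fixes s t h :: real
  assumes "s \<in> {0..h}" "t \<in> {0..h}"
  shows "\<bar>x * s ^ i * t ^ j\<bar> \<le> \<bar>x\<bar> * h ^ i * h ^ j"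
  using assms by (auto simp: abs_mult intro!: mult_mono power_mono)

lemma double_series_has_sum:
  assumes "box_summable c h" "s \<in> {0..h}" "t \<in> {0..h}"
  shows "((\<lambda>(i, j). c i j * s ^ i * t ^ j) has_sum double_series c s t) UNIV"
proof -
  have "(\<lambda>x. norm (case x of (i, j) \<Rightarrow> c i j * s ^ i * t ^ j)) summable_on UNIV"
    by (rule Infinite_Sum.abs_summable_on_comparison_test'[OF assms(1)[unfolded box_summable_def]])
       (use double_term_le[OF assms(2,3)] in auto)
  then show ?thesis
    unfolding double_series_def by (rule has_sum_infsum[OF abs_summable_summable])
qed

lemma uniform_limit_double_series:
  assumes "box_summable c h"
  shows "uniform_limit ({a..a + h} \<times> {b..b + h})
    (\<lambda>F (s, t). \<Sum>(i, j)\<in>F. c i j * (s - a) ^ i * (t - b) ^ j)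
    (\<lambda>(s, t). double_series c (s - a) (t - b)) (finite_subsets_at_top UNIV)"
proof -
  have le: "norm (case x of (i, j) \<Rightarrow> c i j * (fst y - a) ^ i * (snd y - b) ^ j)
      \<le> (case x of (i, j) \<Rightarrow> \<bar>c i j\<bar> * h ^ i * h ^ j)"
    if "y \<in> {a..a + h} \<times> {b..b + h}" for x y
    using that double_term_le[of "fst y - a" h "snd y - b" "c (fst x) (snd x)" "fst x" "snd x"]
    by (auto simp: case_prod_unfold)
  have "uniform_limit ({a..a + h} \<times> {b..b + h})
    (\<lambda>F y. \<Sum>x\<in>F. case x of (i, j) \<Rightarrow> c i j * (fst y - a) ^ i * (snd y - b) ^ j)
    (\<lambda>y. \<Sum>\<^sub>\<infinity>x. case x of (i, j) \<Rightarrow> c i j * (fst y - a) ^ i * (snd y - b) ^ j)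
    (finite_subsets_at_top UNIV)"
    by (rule Weierstrass_m_test_general[OF le assms[unfolded box_summable_def]])
  then show ?thesis by (simp add: case_prod_unfold double_series_def)
qed

lemma row_summable:
  assumes "box_summable c h" "h > 0"
  shows "summable (\<lambda>j. \<bar>c i j\<bar> * h ^ j)"
proof -
  have "(\<lambda>j. \<bar>c i j\<bar> * h ^ i * h ^ j) summable_on UNIV"
    using summable_on_SigmaD1[of "\<lambda>i j. \<bar>c i j\<bar> * h ^ i * h ^ j" UNIV "\<lambda>_. UNIV" i]
      assms by (simp add: box_summable_def)
  then have "summable (\<lambda>j. \<bar>c i j\<bar> * h ^ i * h ^ j)" by (rule summable_on_imp_summable)
  then have "summable (\<lambda>j. h ^ i * (\<bar>c i j\<bar> * h ^ j))" by (simp add: mult_ac)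
  then show ?thesis using assms(2) by (subst (asm) summable_cmult_iff) simp
qed

text \<open>
  Summing by rows identifies a horizontal slice of the double series as the power series whose
  coefficients are the matrix applied to the powers of \<open>t\<close>. At \<open>t = h\<close> this is the recursion that hands
  the top edge of a tile to the next one.
\<close>

lemma double_series_by_rows:
  assumes c: "box_summable c h" "h > 0" and st: "s \<in> {0..h}" "t \<in> {0..h}"
  shows "((\<lambda>i. mat_seq c (eta t) i * s ^ i) has_sum double_series c s t) UNIV"
proof -
  have "((\<lambda>j. c i j * s ^ i * t ^ j) has_sum mat_seq c (eta t) i * s ^ i) UNIV" for i
  proof -
    have row: "summable (\<lambda>j. norm (c i j * t ^ j))"
      by (rule summable_comparison_test'[OF row_summable[OF c, of i], of 0])
         (use st in \<open>auto simp: abs_mult intro!: mult_left_mono power_mono\<close>)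
    have "((\<lambda>j. c i j * t ^ j) has_sum mat_seq c (eta t) i) UNIV"
      unfolding mat_seq_def eta_def
      by (rule norm_summable_imp_has_sum[OF row summable_sums[OF summable_norm_cancel[OF row]]])
    from has_sum_cmult_left[OF this, of "s ^ i"] show ?thesis by (simp add: mult_ac)
  qed
  moreover have "((\<lambda>(i, j). c i j * s ^ i * t ^ j) has_sum double_series c s t) (Sigma UNIV (\<lambda>_. UNIV))"
    using double_series_has_sum[OF c(1) st] by simp
  ultimately show ?thesis
    using has_sum_SigmaD[where f = "\<lambda>(i, j). c i j * s ^ i * t ^ j" and A = UNIV and B = "\<lambda>_. UNIV"
        and S = "double_series c s t" and g = "\<lambda>i. mat_seq c (eta t) i * s ^ i"] by simp
qed

text \<open>
  Row summation of the series of absolute values, at the corner \<open>(h, h)\<close>.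
\<close>

lemma mat_seq_abs_summable:
  assumes c: "box_summable c h" "h > 0"
  shows "summable (\<lambda>i. \<bar>mat_seq c (eta h) i\<bar> * h ^ i)"
proof -
  have "box_summable (\<lambda>i j. \<bar>c i j\<bar>) h" using c by (simp add: box_summable_def)
  then have "(\<lambda>i. mat_seq (\<lambda>i j. \<bar>c i j\<bar>) (eta h) i * h ^ i) summable_on UNIV"
    using double_series_by_rows[of "\<lambda>i j. \<bar>c i j\<bar>" h h h] c(2) unfolding summable_on_def by auto
  then have "summable (\<lambda>i. mat_seq (\<lambda>i j. \<bar>c i j\<bar>) (eta h) i * h ^ i)"
    by (rule summable_on_imp_summable)
  moreover
  have "\<bar>mat_seq c (eta h) i\<bar> \<le> mat_seq (\<lambda>i j. \<bar>c i j\<bar>) (eta h) i" for i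
    using summable_rabs[of "\<lambda>j. c i j * h ^ j"] row_summable[OF c, of i] c(2)
    by (simp add: mat_seq_def eta_def abs_mult)
  then have "norm (\<bar>mat_seq c (eta h) i\<bar> * h ^ i) \<le> mat_seq (\<lambda>i j. \<bar>c i j\<bar>) (eta h) i * h ^ i" for i
    using c(2) by (simp add: abs_mult mult_right_mono)
  ultimately show ?thesis by (rule summable_comparison_test')
qed

lemma double_series_0_right:
  assumes "box_summable c h" "h > 0" "s \<in> {0..h}"
  shows "(\<lambda>i. c i 0 * s ^ i) sums double_series c s 0"
proof -
  have "mat_seq c (eta 0) i = c i 0" for i by (simp add: mat_seq_def eta_def powser_zero)
  then show ?thesis
    using has_sum_imp_sums[OF double_series_by_rows[OF assms(1,2,3), of 0]] assms(2) by simp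
qed

lemma box_summable_transpose:
  "box_summable c h \<Longrightarrow> box_summable (inf_transpose c) h"
  using summable_on_swap[of "\<lambda>(i, j). \<bar>c i j\<bar> * h ^ i * h ^ j" UNIV UNIV]
  by (simp add: box_summable_def inf_transpose_def mult_ac)

lemma double_series_transpose:
  "double_series (inf_transpose c) t s = double_series c s t"
proof -
  have "double_series c s t = infsum ((\<lambda>(i, j). c i j * s ^ i * t ^ j) \<circ> prod.swap) UNIV"
    using infsum_reindex[of prod.swap UNIV "\<lambda>(i, j). c i j * s ^ i * t ^ j"]
    by (simp add: double_series_def)
  then show ?thesis
    by (simp add: double_series_def inf_transpose_def o_def case_prod_unfold mult_ac)
qed

section \<open>Series solution of the Goursat problem with constant coefficient\<close>

definition goursat_coeff :: "real \<Rightarrow> (nat \<Rightarrow> real) \<Rightarrow> (nat \<Rightarrow> real) \<Rightarrow> inf_matrix" where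
  "goursat_coeff \<rho> \<alpha> \<beta> i j = \<rho> ^ min i j * toeplitz \<alpha> \<beta> i j * W_mat i j"

lemma W_mat_altdef: "W_mat i j = fact (max i j - min i j) / (fact i * fact j)"
  by (auto simp: W_mat_def max_def min_def mult.commute)

text \<open>
  The differential equation on the level of coefficients: along a diagonal the Toeplitz factor is
  constant and the numerator of \<open>W_mat_altdef\<close> does not change.
\<close>

lemma goursat_coeff_Suc_Suc:
  "goursat_coeff \<rho> \<alpha> \<beta> (Suc i) (Suc j) * (real (Suc i) * real (Suc j)) = \<rho> * goursat_coeff \<rho> \<alpha> \<beta> i j"
proof -
  have "W_mat (Suc i) (Suc j) * (real (Suc i) * real (Suc j)) = W_mat i j"
    by (simp add: W_mat_altdef divide_simps del: of_nat_Suc)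
  moreover have "toeplitz \<alpha> \<beta> (Suc i) (Suc j) = toeplitz \<alpha> \<beta> i j" by (simp add: toeplitz_def)
  ultimately show ?thesis by (simp add: goursat_coeff_def mult.assoc)
qed

lemma goursat_coeff_boundary:
  shows "goursat_coeff \<rho> \<alpha> \<beta> i 0 = \<alpha> i"
    and "\<alpha> 0 = \<beta> 0 \<Longrightarrow> goursat_coeff \<rho> \<alpha> \<beta> 0 j = \<beta> j"
  by (auto simp: goursat_coeff_def W_mat_altdef toeplitz_def)

lemma goursat_coeff_transpose:
  assumes "\<alpha> 0 = \<beta> 0"
  shows "inf_transpose (goursat_coeff \<rho> \<alpha> \<beta>) = goursat_coeff \<rho> \<beta> \<alpha>"
  using assms
  by (auto simp: fun_eq_iff inf_transpose_def goursat_coeff_def W_mat_def toeplitz_def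
        max.commute min.commute)

text \<open>
  In the position \<open>(j + r, j)\<close> the factorial weight is \<open>r! / ((j + r)! j!) \<le> 1/j!\<close>. The terms on and below
  the diagonal are therefore dominated by the product of an exponential series in \<open>|\<rho>| h\<^sup>2\<close> and the
  series of the \<open>|\<alpha>\<^sub>r| h\<^sup>r\<close>.
\<close>

lemma goursat_lower_summable:
  assumes "h > 0" "summable (\<lambda>r. \<bar>\<alpha> r\<bar> * h ^ r)"
  shows "(\<lambda>(i, j). \<bar>goursat_coeff \<rho> \<alpha> \<beta> i j\<bar> * h ^ i * h ^ j) summable_on {(i, j). j \<le> i}"
proof -
  define g where "g = (\<lambda>(j, r). inverse (fact j) * (\<bar>\<rho>\<bar> * h\<^sup>2) ^ j * (\<bar>\<alpha> r\<bar> * h ^ r))"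
  have "(\<lambda>r. \<bar>\<alpha> r\<bar> * h ^ r) summable_on UNIV"
    using assms by (intro summable_nonneg_imp_summable_on) auto
  then have hs: "((\<lambda>r. \<bar>\<alpha> r\<bar> * h ^ r) has_sum (\<Sum>\<^sub>\<infinity>r. \<bar>\<alpha> r\<bar> * h ^ r)) UNIV"
    by (rule has_sum_infsum)
  have "(\<lambda>j. inverse (fact j) * (\<bar>\<rho>\<bar> * h\<^sup>2) ^ j * (\<Sum>\<^sub>\<infinity>r. \<bar>\<alpha> r\<bar> * h ^ r)) summable_on UNIV"
    using summable_exp[of "\<bar>\<rho>\<bar> * h\<^sup>2"] assms(1)
    by (intro summable_on_cmult_left summable_nonneg_imp_summable_on) auto
  moreover have "((\<lambda>r. g (j, r)) has_sum inverse (fact j) * (\<bar>\<rho>\<bar> * h\<^sup>2) ^ j *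
      (\<Sum>\<^sub>\<infinity>r. \<bar>\<alpha> r\<bar> * h ^ r)) UNIV" for j
    unfolding g_def prod.case by (rule has_sum_cmult_right[OF hs])
  ultimately have "g summable_on Sigma UNIV (\<lambda>_. UNIV)"
    using assms(1) by (intro summable_on_SigmaI) (auto simp: g_def)
  then have g: "g summable_on UNIV" by simp
  have "(\<lambda>(j, r). \<bar>goursat_coeff \<rho> \<alpha> \<beta> (j + r) j\<bar> * h ^ (j + r) * h ^ j) summable_on UNIV"
  proof (rule summable_on_comparison_test[OF g])
    fix z :: "nat \<times> nat"
    obtain j r where z: "z = (j, r)" by force
    have "fact r / fact (j + r) \<le> (1 :: real)" by (simp add: fact_mono)
    then have "W_mat (j + r) j \<le> inverse (fact j)" 
      by (simp add: W_mat_altdef field_simps fact_mono)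
    moreover have "0 \<le> W_mat (j + r) j" by (simp add: W_mat_def)
    ultimately have "\<bar>W_mat (j + r) j\<bar> \<le> inverse (fact j)" by simp
    then have "\<bar>W_mat (j + r) j\<bar> * ((\<bar>\<rho>\<bar> * h\<^sup>2) ^ j * (\<bar>\<alpha> r\<bar> * h ^ r))
        \<le> inverse (fact j) * ((\<bar>\<rho>\<bar> * h\<^sup>2) ^ j * (\<bar>\<alpha> r\<bar> * h ^ r))"
      using assms(1) by (intro mult_right_mono) auto
    then show "(case z of (j, r) \<Rightarrow> \<bar>goursat_coeff \<rho> \<alpha> \<beta> (j + r) j\<bar> * h ^ (j + r) * h ^ j) \<le> g z"
      using assms(1)
      by (simp add: z g_def goursat_coeff_def toeplitz_def abs_mult power_abs power_add
          power_mult_distrib power2_eq_square mult_ac)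
  qed (use assms(1) in auto)
  moreover have "inj (\<lambda>(j, r). (j + r, j :: nat))" by (auto simp: inj_on_def)
  moreover have "range (\<lambda>(j, r). (j + r, j)) = {(i, j). j \<le> (i :: nat)}"
    by (auto simp: image_iff le_iff_add)
  ultimately show ?thesis
    using summable_on_reindex[of "\<lambda>(j, r). (j + r, j)" UNIV
        "\<lambda>(i, j). \<bar>goursat_coeff \<rho> \<alpha> \<beta> i j\<bar> * h ^ i * h ^ j"]
    by (simp add: o_def case_prod_unfold)
qed

lemma goursat_coeff_box_summable:
  assumes h: "h > 0" and compat: "\<alpha> 0 = \<beta> 0"
    and a: "summable (\<lambda>r. \<bar>\<alpha> r\<bar> * h ^ r)" and b: "summable (\<lambda>r. \<bar>\<beta> r\<bar> * h ^ r)"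
  shows "box_summable (goursat_coeff \<rho> \<alpha> \<beta>) h"
proof -
  let ?f = "\<lambda>\<alpha> \<beta> (i, j). \<bar>goursat_coeff \<rho> \<alpha> \<beta> i j\<bar> * h ^ i * h ^ j"
  have tr: "goursat_coeff \<rho> \<alpha> \<beta> i j = goursat_coeff \<rho> \<beta> \<alpha> j i" for i j
    using goursat_coeff_transpose[of \<alpha> \<beta> \<rho>, OF compat] by (metis inf_transpose_def)
  have "?f \<beta> \<alpha> summable_on {(i, j). j \<le> i}"
    by (rule goursat_lower_summable[OF h b])
  then have "?f \<beta> \<alpha> summable_on (prod.swap ` {(i, j). i \<le> j})"
    by (rule summable_on_subset) auto
  then have "?f \<alpha> \<beta> summable_on {(i, j). i \<le> j}"
    by (subst (asm) summable_on_reindex) (auto simp: o_def case_prod_unfold tr mult_ac)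
  then have "?f \<alpha> \<beta> summable_on {(i, j). i < j}"
    by (rule summable_on_subset) auto
  with goursat_lower_summable[OF h a]
  have "?f \<alpha> \<beta> summable_on ({(i, j). j \<le> i} \<union> {(i, j). i < j})"
    by (rule summable_on_Un_disjoint) auto
  also have "{(i, j). j \<le> i} \<union> {(i, j). i < j} = (UNIV :: (nat \<times> nat) set)" by auto
  finally show ?thesis by (simp add: box_summable_def)
qed

definition box_sum :: "inf_matrix \<Rightarrow> real \<Rightarrow> real \<Rightarrow> nat \<Rightarrow> real \<times> real \<Rightarrow> real" where
  "box_sum c a b n = (\<lambda>(s, t). \<Sum>i\<le>n. \<Sum>j\<le>n. c i j * (s - a) ^ i * (t - b) ^ j)"

text \<open>
  Differentiation kills the terms with \<open>i = 0\<close> or \<open>j = 0\<close> and lowers both degrees by one, which is why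
  the order of the partial sum drops.
\<close>

lemma box_sum_mixed_partial:
  assumes "\<And>i j. c (Suc i) (Suc j) * (real (Suc i) * real (Suc j)) = \<rho> * c i j"
  shows "has_mixed_partial_on (box_sum c a b (Suc n)) (\<lambda>p. \<rho> * box_sum c a b n p) D"
proof -
  have "has_mixed_partial_on (\<lambda>p. \<Sum>i\<le>Suc n. \<Sum>j\<le>Suc n. c i j * (case p of (s, t) \<Rightarrow> (s - a) ^ i * (t - b) ^ j))
     (\<lambda>p. \<Sum>i\<le>Suc n. \<Sum>j\<le>Suc n. c i j *
        (case p of (s, t) \<Rightarrow> (real i * (s - a) ^ (i - 1)) * (real j * (t - b) ^ (j - 1)))) D"
    by (intro has_mixed_partial_on_sum has_mixed_partial_on_cmult has_mixed_partial_on_product)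
       (auto intro!: derivative_eq_intros)
  moreover have "(\<Sum>i\<le>Suc n. \<Sum>j\<le>Suc n. c i j *
        (case p of (s, t) \<Rightarrow> (real i * (s - a) ^ (i - 1)) * (real j * (t - b) ^ (j - 1))))
      = \<rho> * box_sum c a b n p" for p
  proof -
    obtain s t where p: "p = (s, t)" by force
    have key: "c (Suc i) (Suc j) * (real (Suc i) * (s - a) ^ i * (real (Suc j) * (t - b) ^ j))
        = \<rho> * (c i j * (s - a) ^ i * (t - b) ^ j)" for i j
      using arg_cong[OF assms[of i j], of "\<lambda>x. x * ((s - a) ^ i * (t - b) ^ j)"]
      by (simp only: mult_ac)
    show ?thesis
      by (simp add: key p box_sum_def sum.atMost_Suc_shift sum_distrib_left del: sum.atMost_Suc of_nat_Suc)
  qed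
  ultimately show ?thesis by (simp add: box_sum_def case_prod_unfold mult.assoc)
qed

lemma uniform_limit_box_sum:
  assumes "box_summable c h"
  shows "uniform_limit ({a..a + h} \<times> {b..b + h}) (box_sum c a b)
    (\<lambda>(s, t). double_series c (s - a) (t - b)) sequentially"
proof -
  have "filterlim (\<lambda>n. {..n} \<times> {..n}) (finite_subsets_at_top UNIV) sequentially"
    unfolding filterlim_finite_subsets_at_top
  proof (intro allI impI)
    fix X :: "(nat \<times> nat) set" assume X: "finite X \<and> X \<subseteq> UNIV"
    define N where "N = Max (fst ` X \<union> snd ` X)"
    have "i \<le> N \<and> j \<le> N" if "(i, j) \<in> X" for i j
      unfolding N_def using X that by (intro conjI Max_ge) force+
    then have "X \<subseteq> {..n} \<times> {..n}" if "n \<ge> N" for n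
      using that by (auto intro: order_trans)
    then show "\<forall>\<^sub>F n in sequentially. finite ({..n} \<times> {..n}) \<and> X \<subseteq> {..n} \<times> {..n} \<and> {..n} \<times> {..n} \<subseteq> UNIV"
      by (intro eventually_mono[OF eventually_ge_at_top[of N]]) auto
  qed
  from filterlim_compose[OF uniform_limit_double_series[OF assms, of a b] this]
  show ?thesis
    unfolding box_sum_def by (simp add: sum.cartesian_product case_prod_unfold)
qed

text \<open>
  The errors of the square partial sums are approximations as required for
  \<open>goursat_uniqueness_limit\<close>, and on the two edges the double series reduces to the given
  edge series.
\<close>

lemma goursat_series_solution:
  assumes h: "h > 0" and compat: "\<alpha> 0 = \<beta> 0"
    and a_sum: "summable (\<lambda>r. \<bar>\<alpha> r\<bar> * h ^ r)" and b_sum: "summable (\<lambda>r. \<bar>\<beta> r\<bar> * h ^ r)"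
    and cont: "continuous_on ({a..a + h} \<times> {b..b + h}) K"
    and mixed: "has_mixed_partial_on K (\<lambda>p. \<rho> * K p) ({a<..<a + h} \<times> {b<..<b + h})"
    and bottom: "\<And>s. s \<in> {0..h} \<Longrightarrow> (\<lambda>i. \<alpha> i * s ^ i) sums K (a + s, b)"
    and left: "\<And>t. t \<in> {0..h} \<Longrightarrow> (\<lambda>j. \<beta> j * t ^ j) sums K (a, b + t)"
    and st: "s \<in> {0..h}" "t \<in> {0..h}"
  shows "K (a + s, b + t) = double_series (goursat_coeff \<rho> \<alpha> \<beta>) s t"
proof -
  define c where "c = goursat_coeff \<rho> \<alpha> \<beta>"
  have c: "box_summable c h"
    unfolding c_def by (rule goursat_coeff_box_summable[OF h compat a_sum b_sum])
  have box_cont: "continuous_on D (box_sum c a b n)" for D n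
    unfolding box_sum_def case_prod_unfold by (intro continuous_intros)
  have c_bottom: "double_series c s 0 = K (a + s, b)" if "s \<in> {0..h}" for s
    using double_series_0_right[OF c h that] bottom[OF that]
    by (simp add: c_def goursat_coeff_boundary sums_unique2)
  have c_left: "double_series c 0 t = K (a, b + t)" if "t \<in> {0..h}" for t
    using double_series_0_right[OF box_summable_transpose[OF c] h that] left[OF that]
    unfolding double_series_transpose
    by (simp add: c_def inf_transpose_def goursat_coeff_boundary(2)[of \<alpha> \<beta>, OF compat] sums_unique2)
  have "(\<lambda>p. K p - (case p of (s, t) \<Rightarrow> double_series c (s - a) (t - b))) (a + s, b + t) = 0"
  proof (rule goursat_uniqueness_limit[where En = "\<lambda>n p. K p - box_sum c a b n p" and \<rho> = \<rho>])
    show "uniform_limit ({a..a + h} \<times> {b..b + h}) (\<lambda>n p. K p - box_sum c a b n p)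
        (\<lambda>p. K p - (case p of (s, t) \<Rightarrow> double_series c (s - a) (t - b))) sequentially"
      by (intro uniform_limit_intros uniform_limit_box_sum c)
    show "has_mixed_partial_on (\<lambda>p. K p - box_sum c a b (Suc n) p)
        (\<lambda>p. \<rho> * (K p - box_sum c a b n p)) ({a<..<a + h} \<times> {b<..<b + h})" for n
      unfolding right_diff_distrib
      by (intro has_mixed_partial_on_diff mixed box_sum_mixed_partial)
         (simp only: c_def goursat_coeff_Suc_Suc)
    show "K (s, b) - (case (s, b) of (s, t) \<Rightarrow> double_series c (s - a) (t - b)) = 0"
      if "s \<in> {a..a + h}" for s
      using c_bottom[of "s - a"] that by simp
    show "K (a, t) - (case (a, t) of (s, t) \<Rightarrow> double_series c (s - a) (t - b)) = 0"
      if "t \<in> {b..b + h}" for t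
      using c_left[of "t - b"] that by simp
  qed (use st in \<open>auto intro!: continuous_on_diff cont box_cont\<close>)
  then show ?thesis by (simp add: c_def)
qed

section \<open>Restriction of the signature kernel to a tile\<close>

lemma C_mat_eq_goursat_coeff:
  "C_mat L x y k l = goursat_coeff (rho_coeff L x y k l) (alpha L x y k l) (beta L x y k l)"
  by (simp add: fun_eq_iff C_mat.simps B_mat.simps hadamard_def A_mat_def goursat_coeff_def)

lemma grid_Suc: "grid L (Suc k) = grid L k + 1 / (real L - 1)"
  by (simp add: grid_def diff_divide_distrib add_divide_distrib)

lemma tile_eq:
  defines "h \<equiv> \<lambda>L. 1 / (real L - 1)"
  shows "tile L k l = {grid L k..grid L k + h L} \<times> {grid L l..grid L l + h L}"
    and "open_tile L k l = {grid L k<..<grid L k + h L} \<times> {grid L l<..<grid L l + h L}"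
  by (simp_all add: tile_def open_tile_def grid_Suc h_def)

lemma grid_cell_unique:
  assumes "s \<in> {grid L k<..<grid L (k + 1)}" "s \<in> {grid L k'<..<grid L (k' + 1)}" "L \<ge> 2"
  shows "k = k'"
proof -
  have "real k - 1 < s * (real L - 1)" "s * (real L - 1) < real k"
    "real k' - 1 < s * (real L - 1)" "s * (real L - 1) < real k'"
    using assms by (auto simp: grid_def pos_divide_less_eq pos_less_divide_eq)
  then have "real k < real (Suc k')" "real k' < real (Suc k)" by auto
  then show ?thesis by linarith
qed

lemma rho_fun_on_open_tile:
  assumes "L \<ge> 2" "k \<in> {1..L - 1}" "l \<in> {1..L - 1}" "p \<in> open_tile L k l"
  shows "rho_fun L x y p = rho_coeff L x y k l"
proof -
  have ind: "indicator (open_tile L k' l') p = (if k' = k then if l' = l then 1 else 0 else (0 :: real))"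
    for k' l'
    using assms(1,4) grid_cell_unique[of "fst p" L k k'] grid_cell_unique[of "snd p" L l l']
    by (auto simp: open_tile_def indicator_def)
  have "rho_fun L x y p = (\<Sum>k'\<in>{1..L - 1}. if k' = k then
      (\<Sum>l'\<in>{1..L - 1}. if l' = l then rho_coeff L x y k' l' else 0) else 0)"
    unfolding rho_fun_def ind by (intro sum.cong refl) (simp add: if_distrib[of "(*) _"] cong: if_cong)
  then show ?thesis using assms(2,3) by simp
qed

lemma tile_subset_unit_square:
  assumes "L \<ge> 2" "k \<in> {1..L - 1}" "l \<in> {1..L - 1}"
  shows "tile L k l \<subseteq> {0..1} \<times> {0..1}"
proof -
  have "0 \<le> grid L j \<and> grid L (j + 1) \<le> 1" if "j \<in> {1..L - 1}" for j
    using that assms(1) by (auto simp: grid_def field_simps)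
  from this[OF assms(2)] this[OF assms(3)] show ?thesis by (auto simp: tile_def)
qed

lemma signature_kernel_mixed_partial:
  assumes "L \<ge> 2" "is_signature_kernel L x y K" "k \<in> {1..L - 1}" "l \<in> {1..L - 1}"
  shows "has_mixed_partial_on K (\<lambda>p. rho_coeff L x y k l * K p) (open_tile L k l)"
proof -
  have "open_tile L k l \<subseteq> open_tiles L" unfolding open_tiles_def using assms(3,4) by blast
  then have "has_mixed_partial_on K (\<lambda>p. rho_fun L x y p * K p) (open_tile L k l)"
    using assms(2) unfolding is_signature_kernel_def by (blast intro: has_mixed_partial_on_subset)
  then show ?thesis
    by (rule has_mixed_partial_on_cong) (use assms in \<open>simp add: rho_fun_on_open_tile\<close>)
qed

lemma delta_seq_powser: "(\<lambda>r. delta_seq r * s ^ r) sums 1"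
proof -
  have "(\<lambda>r. delta_seq r * s ^ r) = (\<lambda>r. if r = 0 then 1 else 0)"
    by (auto simp: delta_seq_def)
  then show ?thesis using sums_single[of 0 "\<lambda>_. 1 :: real"] by simp
qed

lemma delta_seq_abs_summable: "summable (\<lambda>r. \<bar>delta_seq r\<bar> * h ^ r)"
proof -
  have "(\<lambda>r. \<bar>delta_seq r\<bar> * h ^ r) = (\<lambda>r. delta_seq r * h ^ r)" by (auto simp: delta_seq_def)
  then show ?thesis using delta_seq_powser[of h] by (simp add: sums_summable)
qed

section \<open>Recursion over the tiles\<close>

definition tile_expansion ::
    "nat \<Rightarrow> (nat \<Rightarrow> real ^ 'd) \<Rightarrow> (nat \<Rightarrow> real ^ 'd) \<Rightarrow> (real \<times> real \<Rightarrow> real) \<Rightarrow> nat \<Rightarrow> nat \<Rightarrow> bool" where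
  "tile_expansion L x y K k l \<longleftrightarrow>
     box_summable (C_mat L x y k l) (1 / (real L - 1)) \<and>
     (\<forall>s\<in>{0..1 / (real L - 1)}. \<forall>t\<in>{0..1 / (real L - 1)}.
        K (grid L k + s, grid L l + t) = double_series (C_mat L x y k l) s t)"

text \<open>
  On the bottom row of tiles the edge lies on the axis, where \<open>K\<close> is 1; otherwise it is the top edge of
  the tile below, whose expansion is summed by rows.
\<close>

lemma alpha_bottom_edge:
  assumes L: "L \<ge> 2" and K: "is_signature_kernel L x y K"
    and kl: "k \<in> {1..L - 1}" "l \<in> {1..L - 1}"
    and below: "l > 1 \<Longrightarrow> tile_expansion L x y K k (l - 1)"
  defines "h \<equiv> 1 / (real L - 1)"
  shows "summable (\<lambda>r. \<bar>alpha L x y k l r\<bar> * h ^ r)"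
    and "s \<in> {0..h} \<Longrightarrow> (\<lambda>r. alpha L x y k l r * s ^ r) sums K (grid L k + s, grid L l)"
proof -
  have h: "h > 0" using L by (simp add: h_def)
  have "summable (\<lambda>r. \<bar>alpha L x y k l r\<bar> * h ^ r) \<and>
    (s \<in> {0..h} \<longrightarrow> (\<lambda>r. alpha L x y k l r * s ^ r) sums K (grid L k + s, grid L l))"
  proof (cases "l > 1")
    case False
    then have l: "l = 1" using kl by simp
    have "K (grid L k + s, grid L l) = 1" if "s \<in> {0..h}"
    proof -
      have "(grid L k + s, grid L l) \<in> tile L k l" using that h by (auto simp: tile_eq h_def)
      then have "grid L k + s \<in> {0..1}" using tile_subset_unit_square[OF L kl] by auto
      then show ?thesis using K by (simp add: is_signature_kernel_def l grid_def)
    qed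
    then show ?thesis
      using delta_seq_powser[of s] delta_seq_abs_summable[of h] by (simp add: alpha.simps l)
  next
    case True
    then have "Suc (l - 1) = l" by simp
    then have l: "grid L (l - 1) + h = grid L l" using grid_Suc[of L "l - 1"] by (simp add: h_def)
    note below = below[OF True, unfolded tile_expansion_def, folded h_def]
    have "alpha L x y k l = mat_seq (C_mat L x y k (l - 1)) (eta h)"
      using True by (simp add: alpha.simps h_def)
    moreover have "double_series (C_mat L x y k (l - 1)) s h = K (grid L k + s, grid L l)"
      if "s \<in> {0..h}"
      using bspec[OF bspec[OF conjunct2[OF below]], of s h] that h by (simp add: l[simplified])
    ultimately show ?thesis
      using mat_seq_abs_summable[of "C_mat L x y k (l - 1)" h] below h
        has_sum_imp_sums[OF double_series_by_rows[of "C_mat L x y k (l - 1)" h s h]] by auto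
  qed
  then show "summable (\<lambda>r. \<bar>alpha L x y k l r\<bar> * h ^ r)"
    "s \<in> {0..h} \<Longrightarrow> (\<lambda>r. alpha L x y k l r * s ^ r) sums K (grid L k + s, grid L l)" by auto
qed

text \<open>
  The reflection of \<open>alpha_bottom_edge\<close>: summing the expansion of the left neighbour by columns is
  summing the transposed series by rows.
\<close>

lemma beta_left_edge:
  assumes L: "L \<ge> 2" and K: "is_signature_kernel L x y K"
    and kl: "k \<in> {1..L - 1}" "l \<in> {1..L - 1}"
    and left: "k > 1 \<Longrightarrow> tile_expansion L x y K (k - 1) l"
  defines "h \<equiv> 1 / (real L - 1)"
  shows "summable (\<lambda>r. \<bar>beta L x y k l r\<bar> * h ^ r)"
    and "t \<in> {0..h} \<Longrightarrow> (\<lambda>r. beta L x y k l r * t ^ r) sums K (grid L k, grid L l + t)"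
proof -
  have h: "h > 0" using L by (simp add: h_def)
  have "summable (\<lambda>r. \<bar>beta L x y k l r\<bar> * h ^ r) \<and>
    (t \<in> {0..h} \<longrightarrow> (\<lambda>r. beta L x y k l r * t ^ r) sums K (grid L k, grid L l + t))"
  proof (cases "k > 1")
    case False
    then have k: "k = 1" using kl by simp
    have "K (grid L k, grid L l + t) = 1" if "t \<in> {0..h}"
    proof -
      have "(grid L k, grid L l + t) \<in> tile L k l" using that h by (auto simp: tile_eq h_def)
      then have "grid L l + t \<in> {0..1}" using tile_subset_unit_square[OF L kl] by auto
      then show ?thesis using K by (simp add: is_signature_kernel_def k grid_def)
    qed
    then show ?thesis
      using delta_seq_powser[of t] delta_seq_abs_summable[of h] by (simp add: beta.simps k)
  next
    case True
    then have "Suc (k - 1) = k" by simp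
    then have k: "grid L (k - 1) + h = grid L k" using grid_Suc[of L "k - 1"] by (simp add: h_def)
    define c where "c = inf_transpose (C_mat L x y (k - 1) l)"
    note left = left[OF True, unfolded tile_expansion_def, folded h_def]
    have c: "box_summable c h" unfolding c_def using left by (intro box_summable_transpose) simp
    have "beta L x y k l = mat_seq c (eta h)"
      using True by (simp add: beta.simps h_def c_def)
    moreover have "double_series c t h = K (grid L k, grid L l + t)" if "t \<in> {0..h}"
      using bspec[OF bspec[OF conjunct2[OF left]], of h t] that h
      by (simp add: k[simplified] c_def double_series_transpose)
    ultimately show ?thesis
      using mat_seq_abs_summable[OF c h] h has_sum_imp_sums[OF double_series_by_rows[OF c h, of t h]]
      by auto
  qed
  then show "summable (\<lambda>r. \<bar>beta L x y k l r\<bar> * h ^ r)"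
    "t \<in> {0..h} \<Longrightarrow> (\<lambda>r. beta L x y k l r * t ^ r) sums K (grid L k, grid L l + t)" by auto
qed

text \<open>
  Both edge series are evaluated at the common corner, which gives the compatibility of \<open>\<alpha>\<close> and \<open>\<beta>\<close>
  needed to solve the Goursat problem on the tile.
\<close>

lemma tile_expansion_step:
  assumes L: "L \<ge> 2" and K: "is_signature_kernel L x y K"
    and kl: "k \<in> {1..L - 1}" "l \<in> {1..L - 1}"
    and below: "l > 1 \<Longrightarrow> tile_expansion L x y K k (l - 1)"
    and left: "k > 1 \<Longrightarrow> tile_expansion L x y K (k - 1) l"
  shows "alpha L x y k l 0 = beta L x y k l 0" and "tile_expansion L x y K k l"
proof -
  define h where "h = 1 / (real L - 1)"
  have h: "h > 0" using L by (simp add: h_def)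
  note bottom = alpha_bottom_edge[OF L K kl below, folded h_def]
  note left_edge = beta_left_edge[OF L K kl left, folded h_def]
  have "alpha L x y k l 0 = K (grid L k, grid L l)"
    using bottom(2)[of 0] h powser_sums_zero[of "alpha L x y k l"] by (auto intro: sums_unique2)
  moreover have "beta L x y k l 0 = K (grid L k, grid L l)"
    using left_edge(2)[of 0] h powser_sums_zero[of "beta L x y k l"] by (auto intro: sums_unique2)
  ultimately show compat: "alpha L x y k l 0 = beta L x y k l 0" by simp
  have "continuous_on (tile L k l) K"
    using K tile_subset_unit_square[OF L kl]
    by (auto simp: is_signature_kernel_def intro: continuous_on_subset)
  then have "K (grid L k + s, grid L l + t) = double_series (C_mat L x y k l) s t"
    if "s \<in> {0..h}" "t \<in> {0..h}" for s t
    unfolding C_mat_eq_goursat_coeff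
    using h compat bottom left_edge that signature_kernel_mixed_partial[OF L K kl]
    by (intro goursat_series_solution[where h = h]) (simp_all add: tile_eq h_def)
  then show "tile_expansion L x y K k l"
    using goursat_coeff_box_summable[OF h compat bottom(1) left_edge(1)]
    by (simp add: tile_expansion_def C_mat_eq_goursat_coeff h_def)
qed

lemma signature_kernel_tile_expansion:
  assumes L: "L \<ge> 2" and K: "is_signature_kernel L x y K"
    and kl: "k \<in> {1..L - 1}" "l \<in> {1..L - 1}"
  shows "alpha L x y k l 0 = beta L x y k l 0 \<and> tile_expansion L x y K k l"
  using kl
proof (induction "k + l" arbitrary: k l rule: less_induct)
  case less
  have "tile_expansion L x y K k (l - 1)" if "l > 1"
    using less.hyps[of k "l - 1"] less.prems that by (auto simp: Suc_le_eq)
  moreover have "tile_expansion L x y K (k - 1) l" if "k > 1"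
    using less.hyps[of "k - 1" l] less.prems that by (auto simp: Suc_le_eq)
  ultimately show ?case using tile_expansion_step[OF L K less.prems] by blast
qed

theorem proposition2p8:
  fixes x y :: "nat \<Rightarrow> real ^ 'd"
    and L :: nat
    and K :: "real \<times> real \<Rightarrow> real"
  assumes "L \<ge> 2"
    and "is_signature_kernel L x y K"
  shows "\<forall>k\<in>{1..L - 1}. \<forall>l\<in>{1..L - 1}.
    (\<forall>i r. B_mat L x y k l (i + r) i = alpha L x y k l r \<and>
           B_mat L x y k l i (i + r) = beta L x y k l r) \<and>
    uniform_limit (tile L k l)
      (\<lambda>F (s, t). \<Sum>(i, j)\<in>F. C_mat L x y k l i j * (s - grid L k) ^ i * (t - grid L l) ^ j)
      K (finite_subsets_at_top UNIV)"
proof (intro ballI conjI allI)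
  fix k l assume kl: "k \<in> {1..L - 1}" "l \<in> {1..L - 1}"
  have compat: "alpha L x y k l 0 = beta L x y k l 0"
    and expansion: "tile_expansion L x y K k l"
    using signature_kernel_tile_expansion[OF assms kl] by auto
  show "B_mat L x y k l (i + r) i = alpha L x y k l r" for i r
    by (simp add: B_mat.simps toeplitz_def)
  show "B_mat L x y k l i (i + r) = beta L x y k l r" for i r
    using compat by (simp add: B_mat.simps toeplitz_def)
  have "K (s, t) = double_series (C_mat L x y k l) (s - grid L k) (t - grid L l)"
    if "(s, t) \<in> tile L k l" for s t
  proof -
    have "s - grid L k \<in> {0..1 / (real L - 1)}" "t - grid L l \<in> {0..1 / (real L - 1)}"
      using that by (auto simp: tile_eq)
    then have "K (grid L k + (s - grid L k), grid L l + (t - grid L l))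
        = double_series (C_mat L x y k l) (s - grid L k) (t - grid L l)"
      using expansion unfolding tile_expansion_def by blast
    then show ?thesis by simp
  qed
  moreover have "uniform_limit (tile L k l)
      (\<lambda>F (s, t). \<Sum>(i, j)\<in>F. C_mat L x y k l i j * (s - grid L k) ^ i * (t - grid L l) ^ j)
      (\<lambda>(s, t). double_series (C_mat L x y k l) (s - grid L k) (t - grid L l))
      (finite_subsets_at_top UNIV)"
    using expansion unfolding tile_eq tile_expansion_def
    by (intro uniform_limit_double_series) simp
  ultimately show "uniform_limit (tile L k l)
      (\<lambda>F (s, t). \<Sum>(i, j)\<in>F. C_mat L x y k l i j * (s - grid L k) ^ i * (t - grid L l) ^ j)
      K (finite_subsets_at_top UNIV)"
    by (subst (asm) uniform_limit_cong'[where g = "\<lambda>F (s, t). \<Sum>(i, j)\<in>F.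
          C_mat L x y k l i j * (s - grid L k) ^ i * (t - grid L l) ^ j" and i = K]) auto
qed

end
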